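(* Let $\{a_1,a_2,\dots,a_k\}\subset\mathbb{R}$ be a finite set of reals. Then there exist infinitely many Hermite polynomials $H_{4n}$ (i.e. infinitely many $n\in\mathbb{N}$) satisfying $$\min_{1\le j\le k} H_{4n}(a_j)>0,$$ and there exist infinitely many Hermite polynomials $H_{4n+2}$ (i.e. infinitely many $n\in\mathbb{N}$) satisfying $$\max_{1\le j\le k} H_{4n+2}(a_j)<0.$$
   Context: The Hermite polynomials are $H_n(x):=(-1)^n e^{x^2}\frac{d^n}{dx^n}\big(e^{-x^2}\big)$ for $n\in\mathbb{N}$, $x\in\mathbb{R}$. *)

theory Defs
  imports "HOL-Analysis.Analysis"
begin

definition hermite :: "nat \<Rightarrow> real \<Rightarrow> real" where
  "hermite n x = (-1) ^ n * exp (x\<^sup>2) * (deriv ^^ n) (\<lambda>t. exp (- (t\<^sup>2))) x"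

end

theory Submission
  imports Defs "HOL-Real_Asymp.Real_Asymp"
begin

text \<open>
  The reason is the oscillatory asymptotics of the Hermite polynomials of even degree
  \<open>2 m\<close>: on bounded sets,
  \<open>exp (- x\<^sup>2 / 2) * H\<^bsub>2m\<^esub>(x) / H\<^bsub>2m\<^esub>(0) = cos (\<omega> x) + O(1 / \<omega>)\<close> with
  \<open>\<omega> = sqrt (4 m + 1)\<close>, and \<open>H\<^bsub>2m\<^esub>(0)\<close> has the sign \<open>(-1)^m\<close>. Indeed the left-hand side
  solves \<open>v'' = (x\<^sup>2 - \<omega>\<^sup>2) v\<close> with \<open>v(0) = 1\<close> and \<open>v'(0) = 0\<close>, a perturbation of the harmonic
  oscillator that is small compared with \<open>\<omega>\<^sup>2\<close> (lemma \<open>perturbed_oscillator_cos_approx\<close>).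
  So for large \<open>m\<close> the sign of \<open>H\<^bsub>2m\<^esub>\<close> is \<open>(-1)^m\<close> at every given point where
  \<open>cos (\<omega> x) \<ge> 1/2\<close>.

  It remains to find infinitely many \<open>m\<close> in a given residue class modulo 2 for which all
  numbers \<open>\<omega> a\<^sub>j\<close> are close to multiples of \<open>2 \<pi>\<close>. Dirichlet's simultaneous
  approximation theorem gives arbitrarily large real \<open>s\<close> with all \<open>s a\<^sub>j\<close> close to such
  multiples. Since the gaps of the sequence \<open>sqrt (8 n + r)\<close> tend to 0, \<open>s\<close> can be
  replaced by a member of this sequence (lemma \<open>frequently_cos_sqrt_ge_half\<close>). Taking
  \<open>r = 1\<close> and \<open>r = 5\<close> yields the degrees \<open>4 n\<close> and \<open>4 n + 2\<close>.
\<close>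

section \<open>Hermite polynomials and the oscillator equation\<close>

text \<open>
  The three-term recurrence. It serves to differentiate the Gaussian repeatedly: that the
  iterated \<open>deriv\<close> is a genuine derivative is known only once it has a closed form.
\<close>
fun hermite_rec :: "nat \<Rightarrow> real \<Rightarrow> real" where
  "hermite_rec 0 x = 1"
| "hermite_rec (Suc 0) x = 2 * x"
| "hermite_rec (Suc (Suc n)) x = 2 * x * hermite_rec (Suc n) x - 2 * real (Suc n) * hermite_rec n x"

lemma DERIV_hermite_rec:
  "(hermite_rec n has_real_derivative 2 * real n * hermite_rec (n - 1) x) (at x)"
proof (induction n rule: induct_nat_012)
  case 0
  have "hermite_rec 0 = (\<lambda>x. 1)" by auto
  then show ?case by simp
next
  case 1
  have "hermite_rec (Suc 0) = (\<lambda>x. 2 * x)" by auto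
  then show ?case by (auto intro!: derivative_eq_intros)
next
  case (ge2 n)
  have eq: "hermite_rec (Suc (Suc n)) =
      (\<lambda>x. 2 * x * hermite_rec (Suc n) x - 2 * real (Suc n) * hermite_rec n x)"
    by auto
  have D: "((\<lambda>x. 2 * x * hermite_rec (Suc n) x - 2 * real (Suc n) * hermite_rec n x)
      has_real_derivative
        2 * hermite_rec (Suc n) x + (2 * real (Suc n) * hermite_rec (Suc n - 1) x) * (2 * x)
        - 2 * real (Suc n) * (2 * real n * hermite_rec (n - 1) x)) (at x)"
    by (rule derivative_eq_intros ge2 refl | simp)+
  have "2 * hermite_rec (Suc n) x + (2 * real (Suc n) * hermite_rec (Suc n - 1) x) * (2 * x)
        - 2 * real (Suc n) * (2 * real n * hermite_rec (n - 1) x)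
      = 2 * real (Suc (Suc n)) * hermite_rec (Suc (Suc n) - 1) x"
    by (cases n) (auto simp: algebra_simps)
  with D show ?case unfolding eq by simp
qed

lemma hermite_rec_Suc:
  "hermite_rec (Suc n) x = 2 * x * hermite_rec n x - 2 * real n * hermite_rec (n - 1) x"
  by (cases n) auto

lemma deriv_power_gauss:
  "(deriv ^^ n) (\<lambda>t. exp (- (t\<^sup>2))) = (\<lambda>x. (-1) ^ n * hermite_rec n x * exp (- (x\<^sup>2)))"
proof (induction n)
  case 0
  then show ?case by simp
next
  case (Suc n)
  have "((\<lambda>x. (-1) ^ n * hermite_rec n x * exp (- (x\<^sup>2))) has_real_derivative
      (-1) ^ Suc n * hermite_rec (Suc n) x * exp (- (x\<^sup>2))) (at x)" for x :: real
    by (rule derivative_eq_intros DERIV_hermite_rec refl)+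
       (simp add: hermite_rec_Suc[of n] algebra_simps)
  then show ?case by (auto simp: Suc intro!: DERIV_imp_deriv)
qed

lemma hermite_eq_rec: "hermite n = hermite_rec n"
proof
  fix x
  have "hermite n x = ((-1) ^ n * (-1) ^ n) * (exp (x\<^sup>2) * exp (- (x\<^sup>2))) * hermite_rec n x"
    by (simp add: hermite_def deriv_power_gauss)
  then show "hermite n x = hermite_rec n x"
    by (simp flip: exp_add power_mult_distrib)
qed

lemmas DERIV_hermite = DERIV_hermite_rec[folded hermite_eq_rec]
lemmas hermite_Suc = hermite_rec_Suc[folded hermite_eq_rec]

lemma hermite_minus: "hermite n (- x) = (-1) ^ n * hermite n x"
  unfolding hermite_eq_rec
  by (induction n rule: induct_nat_012) (auto simp: algebra_simps)

lemma hermite_odd_zero: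
  assumes "odd n" shows "hermite n 0 = 0"
  using hermite_minus[of n 0] assms by simp

lemma hermite_even_zero_sign: "(-1) ^ m * hermite (2 * m) 0 > 0"
proof (induction m)
  case 0
  then show ?case by (simp add: hermite_eq_rec)
next
  case (Suc m)
  have "(-1) ^ Suc m * hermite (2 * Suc m) 0
      = 2 * real (Suc (2 * m)) * ((-1) ^ m * hermite (2 * m) 0)"
    by (simp add: hermite_eq_rec)
  then show ?case using Suc.IH by (metis mult_pos_pos of_nat_0_less_iff zero_less_Suc zero_less_numeral)
qed

text \<open>
  The Hermite function up to normalization. The factor \<open>exp (- x\<^sup>2 / 2)\<close> removes the first-order
  term from Hermite's equation and does not change signs.
\<close>
definition hermite_fun :: "nat \<Rightarrow> real \<Rightarrow> real" where
  "hermite_fun n x = exp (- (x\<^sup>2) / 2) * hermite n x"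

definition hermite_fun' :: "nat \<Rightarrow> real \<Rightarrow> real" where
  "hermite_fun' n x = exp (- (x\<^sup>2) / 2) * (2 * real n * hermite (n - 1) x - x * hermite n x)"

lemma DERIV_half_gauss:
  "((\<lambda>x::real. exp (- (x\<^sup>2) / 2)) has_real_derivative - x * exp (- (x\<^sup>2) / 2)) (at x)"
  by (auto intro!: derivative_eq_intros)

lemma DERIV_hermite_fun:
  "(hermite_fun n has_real_derivative hermite_fun' n x) (at x)"
  unfolding hermite_fun_def [abs_def] hermite_fun'_def
  by (rule derivative_eq_intros DERIV_half_gauss DERIV_hermite refl)+ (simp add: algebra_simps)

lemma DERIV_hermite_fun':
  "(hermite_fun' n has_real_derivative (x\<^sup>2 - (2 * real n + 1)) * hermite_fun n x) (at x)"
proof -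
  have "((\<lambda>x. 2 * real n * hermite (n - 1) x - x * hermite n x) has_real_derivative
      x * (2 * real n * hermite (n - 1) x) - (2 * real n + 1) * hermite n x) (at x)"
  proof (cases n)
    case 0
    then show ?thesis
      using DERIV_hermite[of 0] by (auto intro!: derivative_eq_intros)
  next
    case (Suc m)
    show ?thesis
      unfolding Suc diff_Suc_1
      by (rule derivative_eq_intros DERIV_hermite refl)+
         (simp add: hermite_Suc[of m] algebra_simps)
  qed
  from DERIV_mult[OF DERIV_half_gauss this] show ?thesis
    by (simp add: hermite_fun_def hermite_fun'_def [abs_def] algebra_simps power2_eq_square)
qed

section \<open>Solutions of the oscillator equation for high frequency\<close>

text \<open>
  The energy \<open>v'\<^sup>2 + (\<omega>\<^sup>2 - t\<^sup>2) v\<^sup>2\<close> decreases for \<open>t \<ge> 0\<close>, because its derivative is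
  \<open>- 2 t v\<^sup>2\<close>. As \<open>\<omega>\<^sup>2 - t\<^sup>2\<close> is at least \<open>\<omega>\<^sup>2 / 2\<close>, this bounds \<open>v\<close> independently of \<open>\<omega>\<close>.
\<close>
lemma perturbed_oscillator_bounded:
  fixes v v' :: "real \<Rightarrow> real"
  assumes v: "\<And>t. (v has_real_derivative v' t) (at t)"
    and v': "\<And>t. (v' has_real_derivative (t\<^sup>2 - \<omega>\<^sup>2) * v t) (at t)"
    and init: "v 0 = 1" "v' 0 = 0"
    and "\<omega> > 0" "0 \<le> x" "2 * x\<^sup>2 \<le> \<omega>\<^sup>2"
  shows "\<bar>v x\<bar> \<le> 2"
proof -
  define E where "E t = (v' t)\<^sup>2 + (\<omega>\<^sup>2 - t\<^sup>2) * (v t)\<^sup>2" for t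
  have E: "(E has_real_derivative (- 2 * t * (v t)\<^sup>2)) (at t)" for t
    unfolding E_def [abs_def]
    by (rule derivative_eq_intros v v' refl)+ (simp add: algebra_simps power2_eq_square)
  have "E x \<le> E 0"
    by (rule DERIV_nonpos_imp_nonincreasing[OF \<open>0 \<le> x\<close>]) (use E in \<open>force\<close>)
  then have "(\<omega>\<^sup>2 - x\<^sup>2) * (v x)\<^sup>2 \<le> \<omega>\<^sup>2"
    using init unfolding E_def by (simp add: add_increasing order_trans[rotated])
  moreover have "\<omega>\<^sup>2 / 2 * (v x)\<^sup>2 \<le> (\<omega>\<^sup>2 - x\<^sup>2) * (v x)\<^sup>2"
    using assms by (intro mult_right_mono) auto
  ultimately have "\<omega>\<^sup>2 * (v x)\<^sup>2 \<le> \<omega>\<^sup>2 * 2" by simp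
  then have "(v x)\<^sup>2 \<le> 2" using \<open>\<omega> > 0\<close> by simp
  then have "(v x)\<^sup>2 \<le> 2\<^sup>2" by simp
  then show ?thesis by (metis abs_le_square_iff abs_numeral)
qed

text \<open>
  Duhamel's principle: \<open>G t\<close> in the proof is the value at \<open>x\<close> of the solution of the
  unperturbed equation \<open>w'' = - \<omega>\<^sup>2 w\<close> with the same value and derivative as \<open>v\<close> at \<open>t\<close>.
  It moves from \<open>cos (\<omega> x)\<close> at \<open>t = 0\<close> to \<open>v x\<close> at \<open>t = x\<close>, with a speed
  proportional to the perturbation \<open>t\<^sup>2 v\<close>, divided by the frequency.
\<close>
lemma perturbed_oscillator_cos_approx:
  fixes v v' :: "real \<Rightarrow> real"
  assumes v: "\<And>t. (v has_real_derivative v' t) (at t)"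
    and v': "\<And>t. (v' has_real_derivative (t\<^sup>2 - \<omega>\<^sup>2) * v t) (at t)"
    and init: "v 0 = 1" "v' 0 = 0"
    and "\<omega> > 0" "0 \<le> x" "2 * x\<^sup>2 \<le> \<omega>\<^sup>2"
  shows "\<bar>v x - cos (\<omega> * x)\<bar> \<le> 2 * x ^ 3 / \<omega>"
proof -
  define G where "G t = v t * cos (\<omega> * (x - t)) + v' t * sin (\<omega> * (x - t)) / \<omega>" for t
  have G: "(G has_real_derivative (t\<^sup>2 * v t * sin (\<omega> * (x - t)) / \<omega>)) (at t)" for t
    unfolding G_def [abs_def] using \<open>\<omega> > 0\<close>
    by (auto intro!: derivative_eq_intros v v' simp: field_simps power2_eq_square)
  have bound: "norm (t\<^sup>2 * v t * sin (\<omega> * (x - t)) / \<omega>) \<le> 2 * x\<^sup>2 / \<omega>" if "t \<in> {0..x}" for t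
  proof -
    have sq: "t\<^sup>2 \<le> x\<^sup>2" using that by (auto intro: power_mono)
    have t2: "2 * t\<^sup>2 \<le> \<omega>\<^sup>2" using sq \<open>2 * x\<^sup>2 \<le> \<omega>\<^sup>2\<close> by linarith
    have "\<bar>v t\<bar> \<le> 2"
      by (rule perturbed_oscillator_bounded[OF v v' init]) (use \<open>\<omega> > 0\<close> that t2 in auto)
    then have "\<bar>t\<^sup>2 * v t * sin (\<omega> * (x - t))\<bar> \<le> x\<^sup>2 * 2 * 1"
      unfolding abs_mult using sq by (intro mult_mono) auto
    then show ?thesis using \<open>\<omega> > 0\<close> by (simp add: divide_right_mono)
  qed
  have "norm (G x - G 0) \<le> 2 * x\<^sup>2 / \<omega> * norm (x - 0)"
    by (rule field_differentiable_bound[where S = "{0..x}"])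
       (use bound \<open>0 \<le> x\<close> in \<open>auto intro: DERIV_subset[OF G]\<close>)
  then show ?thesis
    using \<open>0 \<le> x\<close> init by (simp add: G_def power2_eq_square power3_eq_cube)
qed

text \<open>
  The degree is even, so \<open>\<bar>x\<bar>\<close> may replace \<open>x\<close>, and \<open>v'\<close> vanishes at 0 because the Hermite
  polynomials of odd degree do. A frequency above \<open>4 * \<bar>x\<bar> ^ 3\<close> makes the error in the cosine
  approximation less than the 1/2 that the cosine provides.
\<close>
lemma eventually_hermite_even_sign:
  "\<forall>\<^sub>F m in sequentially. cos (sqrt (4 * real m + 1) * x) \<ge> 1/2 \<longrightarrow> (-1) ^ m * hermite (2 * m) x > 0"
proof -
  have "\<forall>\<^sub>F m in sequentially. sqrt (4 * real m + 1) > 4 * \<bar>x\<bar> ^ 3"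
    by real_asymp
  moreover have "\<forall>\<^sub>F m in sequentially. 4 * real m + 1 \<ge> 2 * x\<^sup>2"
    by real_asymp
  ultimately show ?thesis
  proof eventually_elim
    case (elim m)
    define \<omega> where "\<omega> = sqrt (4 * real m + 1)"
    have \<omega>: "\<omega> > 0" "\<omega>\<^sup>2 = 4 * real m + 1" by (auto simp: \<omega>_def add_nonneg_pos)
    define c where "c = hermite (2 * m) 0"
    have c: "(-1) ^ m * c > 0" "c \<noteq> 0"
      using hermite_even_zero_sign[of m] by (auto simp: c_def)
    have "((\<lambda>t. hermite_fun (2 * m) t / c) has_real_derivative hermite_fun' (2 * m) t / c) (at t)" for t
      by (intro DERIV_cdivide DERIV_hermite_fun)
    moreover have "((\<lambda>t. hermite_fun' (2 * m) t / c) has_real_derivative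
        (t\<^sup>2 - \<omega>\<^sup>2) * (hermite_fun (2 * m) t / c)) (at t)" for t
      using DERIV_cdivide[OF DERIV_hermite_fun'[of "2 * m" t], of c] by (simp add: \<omega>)
    moreover have "hermite_fun (2 * m) 0 / c = 1" "hermite_fun' (2 * m) 0 / c = 0"
      using c hermite_odd_zero[of "2 * m - 1"]
      by (auto simp: hermite_fun_def hermite_fun'_def c_def)
    ultimately have approx:
      "\<bar>hermite_fun (2 * m) \<bar>x\<bar> / c - cos (\<omega> * \<bar>x\<bar>)\<bar> \<le> 2 * \<bar>x\<bar> ^ 3 / \<omega>"
      by (rule perturbed_oscillator_cos_approx) (use \<omega> elim in auto)
    have abs_x: "hermite (2 * m) \<bar>x\<bar> = hermite (2 * m) x" "cos (\<omega> * \<bar>x\<bar>) = cos (\<omega> * x)"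
      using hermite_minus[of "2 * m" x] by (auto simp: abs_if)
    show ?case
    proof
      assume "cos (sqrt (4 * real m + 1) * x) \<ge> 1/2"
      moreover have "2 * \<bar>x\<bar> ^ 3 / \<omega> < 1/2"
        using elim(1) \<omega>(1) unfolding \<omega>_def[symmetric] by (simp add: field_simps)
      ultimately have "hermite_fun (2 * m) \<bar>x\<bar> / c > 0"
        using approx unfolding abs_x \<omega>_def[symmetric] by linarith
      then have "hermite (2 * m) x / c > 0"
        by (simp add: hermite_fun_def abs_x zero_less_mult_iff mult_less_0_iff zero_less_divide_iff)
      from mult_pos_pos[OF this c(1)] show "(-1) ^ m * hermite (2 * m) x > 0"
        using c(2) by (simp add: mult.commute)
    qed
  qed
qed

section \<open>Simultaneous approximation along a square-root sequence\<close>

lemma cos_ge_half_near_multiple_2pi: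
  assumes "\<bar>y - 2 * pi * of_int p\<bar> \<le> pi / 3"
  shows "cos y \<ge> 1/2"
proof -
  have "cos y = cos (y - 2 * pi * of_int p)"
    by (simp add: cos_diff)
  also have "\<dots> = cos \<bar>y - 2 * pi * of_int p\<bar>" by simp
  also have "\<dots> \<ge> cos (pi / 3)"
    using assms by (intro cos_monotone_0_pi_le) auto
  finally show ?thesis by (simp add: cos_60)
qed

text \<open>
  Dirichlet's theorem bounds the common denominator only from above. Applying it to the
  numbers \<open>Q * x / (2 \<pi>)\<close> makes the frequency \<open>q * Q\<close> at least \<open>Q\<close>.
\<close>
lemma large_frequency_near_multiples_2pi:
  fixes S :: "real set"
  assumes "finite S" "\<epsilon> > 0"
  obtains s where "s \<ge> Q" "\<And>x. x \<in> S \<Longrightarrow> \<exists>p::int. \<bar>s * x - 2 * pi * of_int p\<bar> < \<epsilon>"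
proof -
  obtain f and n :: nat where S: "S = f ` {i. i < n}"
    using finite_imp_nat_seg_image_inj_on[OF \<open>finite S\<close>] by metis
  define Q' where "Q' = max Q 0"
  obtain N :: nat where N: "N > 0" "1 / real N < \<epsilon> / (2 * pi)"
    using real_arch_inverse[of "\<epsilon> / (2 * pi)"] \<open>\<epsilon> > 0\<close> by (auto simp: inverse_eq_divide)
  obtain q p where q: "0 < q"
    and p: "\<And>i. i < n \<Longrightarrow> \<bar>of_int q * (Q' * f i / (2 * pi)) - of_int (p i)\<bar> < 1 / N"
    using Dirichlet_approx_simult[OF N(1), of n "\<lambda>i. Q' * f i / (2 * pi)"] by metis
  show ?thesis
  proof (rule that)
    have "1 * Q' \<le> of_int q * Q'" using q by (intro mult_right_mono) (auto simp: Q'_def)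
    then show "of_int q * Q' \<ge> Q" by (simp add: Q'_def)
  next
    fix x assume "x \<in> S"
    then obtain i where i: "i < n" "x = f i" using S by auto
    have "of_int q * Q' * x - 2 * pi * of_int (p i)
        = 2 * pi * (of_int q * (Q' * f i / (2 * pi)) - of_int (p i))"
      by (simp add: i right_diff_distrib)
    then have "\<bar>of_int q * Q' * x - 2 * pi * of_int (p i)\<bar>
        = 2 * pi * \<bar>of_int q * (Q' * f i / (2 * pi)) - of_int (p i)\<bar>"
      by (simp add: abs_mult)
    also have "\<dots> < 2 * pi * (\<epsilon> / (2 * pi))"
      using p[OF i(1)] N by (intro mult_strict_left_mono) auto
    finally show "\<exists>p::int. \<bar>of_int q * Q' * x - 2 * pi * of_int p\<bar> < \<epsilon>" by auto
  qed
qed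

text \<open>
  If \<open>n\<close> is largest with \<open>\<omega> = sqrt (d n + r) \<le> s\<close>, then
  \<open>s - \<omega> = (s\<^sup>2 - \<omega>\<^sup>2) / (s + \<omega>) \<le> d / s\<close>. Hence passing from \<open>s\<close> to \<open>\<omega>\<close> moves
  the products with the elements of \<open>S\<close> very little when \<open>s\<close> is large.
\<close>
lemma frequently_cos_sqrt_ge_half:
  fixes S :: "real set" and d r :: real
  assumes "finite S" "d > 0" "r \<ge> 0"
  shows "\<exists>\<^sub>F n in sequentially. \<forall>x\<in>S. cos (sqrt (d * real n + r) * x) \<ge> 1/2"
  unfolding frequently_sequentially
proof
  fix N :: nat
  define A where "A = Max (insert 0 (abs ` S))"
  have A: "A \<ge> 0" "\<And>x. x \<in> S \<Longrightarrow> \<bar>x\<bar> \<le> A"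
    using \<open>finite S\<close> by (auto simp: A_def)
  define M where "M = d * (real N + 1) + r"
  have M: "M > 0" using assms by (simp add: M_def add_pos_nonneg)
  obtain s where s: "s \<ge> max (2 * d * A) (max 1 M)"
    and approx: "\<And>x. x \<in> S \<Longrightarrow> \<exists>p::int. \<bar>s * x - 2 * pi * of_int p\<bar> < pi / 6"
    by (rule large_frequency_near_multiples_2pi[OF \<open>finite S\<close>, of "pi / 6" "max (2 * d * A) (max 1 M)"]) auto
  have "s \<ge> 1" using s by simp
  then have "s \<le> s\<^sup>2" by (simp add: power2_eq_square)
  with s have s2: "s\<^sup>2 \<ge> M" by simp
  define n where "n = nat \<lfloor>(s\<^sup>2 - r) / d\<rfloor>"
  have quot: "real N + 1 \<le> (s\<^sup>2 - r) / d"
    using s2 \<open>d > 0\<close> by (simp add: M_def field_simps)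
  then have n: "real n \<le> (s\<^sup>2 - r) / d" "(s\<^sup>2 - r) / d < real n + 1"
    by (auto simp: n_def)
  define \<omega> where "\<omega> = sqrt (d * real n + r)"
  have \<omega>: "\<omega> \<ge> 0" "\<omega>\<^sup>2 = d * real n + r" using assms by (auto simp: \<omega>_def)
  have diff: "\<omega>\<^sup>2 \<le> s\<^sup>2" "s\<^sup>2 - \<omega>\<^sup>2 \<le> d"
    using n \<open>d > 0\<close> by (auto simp: \<omega> field_simps)
  have "\<omega> \<le> s" using power2_le_imp_le[OF diff(1)] \<open>s \<ge> 1\<close> by simp
  have "(s - \<omega>) * s \<le> (s - \<omega>) * (s + \<omega>)"
    using \<open>\<omega> \<le> s\<close> \<omega> by (intro mult_left_mono) auto
  also have "\<dots> \<le> d" using diff by (simp add: algebra_simps power2_eq_square)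
  finally have gap: "(s - \<omega>) * s \<le> d" .
  have "cos (\<omega> * x) \<ge> 1/2" if x: "x \<in> S" for x
  proof -
    obtain p :: int where p: "\<bar>s * x - 2 * pi * of_int p\<bar> < pi / 6" using approx[OF x] by auto
    have "\<bar>\<omega> * x - s * x\<bar> = (s - \<omega>) * \<bar>x\<bar>"
      using \<open>\<omega> \<le> s\<close> by (simp flip: left_diff_distrib add: abs_mult)
    also have "\<dots> \<le> (s - \<omega>) * A"
      using A(2)[OF x] \<open>\<omega> \<le> s\<close> by (intro mult_left_mono) auto
    also have "\<dots> \<le> 1/2"
    proof -
      have "s * ((s - \<omega>) * A) \<le> d * A"
        using mult_right_mono[OF gap A(1)] by (simp add: mult_ac)
      also have "\<dots> \<le> s * (1/2)" using s by simp
      finally show ?thesis using \<open>s \<ge> 1\<close> by (simp only: mult_le_cancel_left_pos)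
    qed
    also have "\<dots> \<le> pi / 6" using pi_gt3 by simp
    finally have "\<bar>\<omega> * x - 2 * pi * of_int p\<bar> \<le> pi / 3" using p by linarith
    then show ?thesis by (rule cos_ge_half_near_multiple_2pi)
  qed
  moreover have "n \<ge> N" using quot n by linarith
  ultimately show "\<exists>n\<ge>N. \<forall>x\<in>S. cos (sqrt (d * real n + r) * x) \<ge> 1/2"
    unfolding \<omega>_def by blast
qed

section \<open>Infinitely many Hermite polynomials of constant sign on a finite set\<close>

lemma infinite_hermite_sign:
  fixes S :: "real set"
  assumes "finite S"
  shows "infinite {n. \<forall>x\<in>S. (-1) ^ c * hermite (4 * n + 2 * c) x > 0}"
proof -
  have idx: "4 * real (2 * n + c) + 1 = 8 * real n + (4 * real c + 1)"
      "(-1 :: real) ^ (2 * n + c) = (-1) ^ c" "2 * (2 * n + c) = 4 * n + 2 * c" for n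
    by (simp_all add: power_add)
  have "\<forall>\<^sub>F m in sequentially. \<forall>x\<in>S. cos (sqrt (4 * real m + 1) * x) \<ge> 1/2
      \<longrightarrow> (-1) ^ m * hermite (2 * m) x > 0"
    by (intro eventually_ball_finite assms ballI eventually_hermite_even_sign)
  moreover have "filterlim (\<lambda>n. 2 * n + c) sequentially sequentially"
    by (intro filterlim_subseq) (simp add: strict_mono_def)
  ultimately have "\<forall>\<^sub>F n in sequentially. \<forall>x\<in>S. cos (sqrt (4 * real (2 * n + c) + 1) * x) \<ge> 1/2
      \<longrightarrow> (-1) ^ (2 * n + c) * hermite (2 * (2 * n + c)) x > 0"
    by (rule eventually_compose_filterlim)
  moreover have "\<exists>\<^sub>F n in sequentially. \<forall>x\<in>S. cos (sqrt (8 * real n + (4 * real c + 1)) * x) \<ge> 1/2"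
    by (intro frequently_cos_sqrt_ge_half assms) auto
  ultimately have "\<exists>\<^sub>F n in sequentially. \<forall>x\<in>S. (-1) ^ c * hermite (4 * n + 2 * c) x > 0"
    unfolding idx by (auto elim!: frequently_rev_mp eventually_mono)
  then show ?thesis
    by (simp add: frequently_cofinite flip: cofinite_eq_sequentially)
qed

theorem theorem5:
  fixes a :: "nat \<Rightarrow> real" and k :: nat
  assumes "k \<ge> 1"
  shows "infinite {n :: nat. (MIN j\<in>{1..k}. hermite (4 * n) (a j)) > 0}
    \<and> infinite {n :: nat. (MAX j\<in>{1..k}. hermite (4 * n + 2) (a j)) < 0}"
proof -
  have "finite (a ` {1..k})" by simp
  from infinite_hermite_sign[OF this, of 0] infinite_hermite_sign[OF this, of 1]
  show ?thesis using assms by simp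
qed

end
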